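(* Let $\mathbb{A}$ be a PCA with elementary sub-PCA $\mathbb{A}'$. The Weihrauch lattice (the poset of Weihrauch degrees of partial multi-valued functions on $\mathbb{A}$, relative to $\mathbb{A}'$) is isomorphic to $\mathfrak{W}(\overline{1})$, where $\mathfrak{W}$ is the Weihrauch doctrine and $\overline 1=\{k\}$ is the terminal object of $\mathsf{Mod}_{\mathsf p}(\mathbb{A},\mathbb{A}')$.
   Context: A partial combinatory algebra (PCA) is a set $\mathbb{A}$ with a partial binary operation $\cdot$ (application, associating to the left; $ab\downarrow$ means that $ab$ is defined; $x\simeq y$ means that $x$ is defined whenever $y$ is, in which case they are equal) for which there exist $k,s\in\mathbb{A}$ such that for all $a,b,c\in\mathbb{A}$: $ka\downarrow$, $kab\simeq a$, $sa\downarrow$, $sab\downarrow$, $sabc\simeq ac(bc)$. An elementary sub-PCA is a subset $\mathbb{A}'\subseteq\mathbb{A}$ closed under (defined) application that contains elements $k,s$ such that $ka\downarrow$, $kab\simeq a$, $sa\downarrow$, $sab\downarrow$ and $sabc\simeq ac(bc)$ for all $a,b,c\in\mathbb{A}$; we fix such $k,s\in\mathbb{A}'$. Fix pairing and projection elements $\mathsf{pair},\mathsf{fst},\mathsf{snd}\in\mathbb{A}'$ with $\mathsf{fst}\cdot(\mathsf{pair}\,a\,b)=a$, $\mathsf{snd}\cdot(\mathsf{pair}\,a\,b)=b$, and write $\langle a,b\rangle:=\mathsf{pair}\,a\,b$. $\wp^*(\mathbb{A})$ is the set of nonempty subsets of $\mathbb{A}$. Assertions such as $a\cdot b\in S$ include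 that $a\cdot b$ is defined. $\mathsf{Mod}_{\mathsf p}(\mathbb{A},\mathbb{A}')$ is the category with objects the subsets $X\subseteq\mathbb{A}$ and morphisms $X\to Y$ the computable functions, i.e. the functions $f\colon X\to Y$ for which there is $a\in\mathbb{A}'$ with $a\cdot x\downarrow$ and $f(x)=a\cdot x$ for all $x\in X$. Its products are $X\times Y=\{\langle x,y\rangle:x\in X,y\in Y\}$. With abuse of notation, $\overline k\cdot p$ denotes the value at $p$ of a computable function $\overline k$. Weihrauch reducibility: a partial multi-valued function on $\mathbb{A}$ with domain $X\subseteq\mathbb{A}$ is a function $f\colon X\to\wp^*(\mathbb{A})$. For $f\colon X\to\wp^*(\mathbb{A})$ and $g\colon Z\to\wp^*(\mathbb{A})$, $f\le_{\mathrm W}g$ iff there are a computable function $\overline k\colon X\to Z$ and $\overline h\in\mathbb{A}'$ such that $(\forall p\in X)(\forall q\in g(\overline k\cdot p))(\overline h\cdot\langle p,q\rangle\in f(p))$. The Weihrauch degrees are the poset reflection of this preorder. Weihrauch doctrine $\mathfrak{W}\colon\mathsf{Mod}_{\mathsf p}(\mathbb{A},\mathbb{A}')^{\mathrm{op}}\to\mathsf{Pos}$: $\mathfrak{W}(X)$ is the poset reflection of the preorder whose objects are generalized Weihrauch predicates on $X$, i.e. functions $F\colon X\to\wp^*(\mathbb{A})^Y$ for some $Y\subseteq\mathbb{A}$ (write $F(x,y)=F(x)(y)$), with $F\le_{\mathsf W}G$, for $F\colon X\to\wp^*(\mathbb{A})^Y$ and $G\colon X\to\wp^*(\mathbb{A})^Z$,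 iff there are a computable function $\overline k\colon X\times Y\to Z$ and $\overline h\in\mathbb{A}'$ such that $(\forall\langle x,y\rangle\in X\times Y)(\forall q\in G(x,\overline k\cdot\langle x,y\rangle))(\overline h\cdot\langle\langle x,y\rangle,q\rangle\in F(x,y))$. It acts on morphisms by precomposition. *)

theory Defs
  imports "HOL-Algebra.Order" "HOL-Library.FuncSet"
begin

section \<open>Partial combinatory algebras\<close>

text \<open>
  The underlying set of a PCA is a whole type \<open>'a\<close>; application is an option-valued binary
  operation, with \<open>None\<close> for ``undefined''.  \<open>papp\<close> is its strict extension, used to evaluate
  compound application terms.
\<close>

definition papp :: "('a \<Rightarrow> 'a \<Rightarrow> 'a option) \<Rightarrow> 'a option \<Rightarrow> 'a option \<Rightarrow> 'a option" where
  "papp app u v = Option.bind u (\<lambda>a. Option.bind v (\<lambda>b. app a b))"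

text \<open>The relation is directed: if the right-hand side is defined, then so is the left-hand
  side, and they are equal.\<close>

definition pcong :: "'a option \<Rightarrow> 'a option \<Rightarrow> bool"  (infix \<open>\<simeq>\<close> 50) where
  "u \<simeq> v \<longleftrightarrow> (\<forall>a. v = Some a \<longrightarrow> u = Some a)"

definition combinators_ks :: "('a \<Rightarrow> 'a \<Rightarrow> 'a option) \<Rightarrow> 'a \<Rightarrow> 'a \<Rightarrow> bool" where
  "combinators_ks app k s \<longleftrightarrow> (\<forall>a b c.
     app k a \<noteq> None \<and>
     papp app (app k a) (Some b) \<simeq> Some a \<and>
     app s a \<noteq> None \<and>
     papp app (app s a) (Some b) \<noteq> None \<and>
     papp app (papp app (app s a) (Some b)) (Some c) \<simeq> papp app (app a c) (app b c))"

locale pca =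
  fixes app :: "'a \<Rightarrow> 'a \<Rightarrow> 'a option"
  assumes ex_combinators: "\<exists>k s. combinators_ks app k s"

locale elementary_sub_pca = pca app
  for app :: "'a \<Rightarrow> 'a \<Rightarrow> 'a option" +
  fixes A' :: "'a set"
  assumes closed: "a \<in> A' \<Longrightarrow> b \<in> A' \<Longrightarrow> app a b = Some c \<Longrightarrow> c \<in> A'"
    and ex_sub_combinators: "\<exists>k\<in>A'. \<exists>s\<in>A'. combinators_ks app k s"

locale elementary_sub_pca_choice = elementary_sub_pca app A'
  for app :: "'a \<Rightarrow> 'a \<Rightarrow> 'a option" and A' :: "'a set" +
  fixes k s pr p0 p1 :: 'a
  assumes k_in: "k \<in> A'" and s_in: "s \<in> A'"
    and ks: "combinators_ks app k s"
    and pr_in: "pr \<in> A'" and p0_in: "p0 \<in> A'" and p1_in: "p1 \<in> A'"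
    and fst_pair: "papp app (Some p0) (papp app (app pr a) (Some b)) = Some a"
    and snd_pair: "papp app (Some p1) (papp app (app pr a) (Some b)) = Some b"

text \<open>The element \<open>\<langle>a, b\<rangle>\<close>; it is defined for all \<open>a\<close>, \<open>b\<close> by the pairing axioms.\<close>

definition pairing :: "('a \<Rightarrow> 'a \<Rightarrow> 'a option) \<Rightarrow> 'a \<Rightarrow> 'a \<Rightarrow> 'a \<Rightarrow> 'a" where
  "pairing app pr a b = the (papp app (app pr a) (Some b))"


section \<open>The category of subsets and computable functions\<close>

definition computable_funs ::
    "('a \<Rightarrow> 'a \<Rightarrow> 'a option) \<Rightarrow> 'a set \<Rightarrow> 'a set \<Rightarrow> 'a set \<Rightarrow> ('a \<Rightarrow> 'a) set" where
  "computable_funs app A' X Y =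
     {f \<in> X \<rightarrow>\<^sub>E Y. \<exists>a\<in>A'. \<forall>x\<in>X. app a x = Some (f x)}"

definition mod_prod :: "('a \<Rightarrow> 'a \<Rightarrow> 'a option) \<Rightarrow> 'a \<Rightarrow> 'a set \<Rightarrow> 'a set \<Rightarrow> 'a set" where
  "mod_prod app pr X Y = {pairing app pr x y |x y. x \<in> X \<and> y \<in> Y}"

lemma (in elementary_sub_pca_choice) singleton_k_terminal:
  "\<exists>!f. f \<in> computable_funs app A' X {k}"
proof
  obtain c where c: "app k k = Some c"
    using ks unfolding combinators_ks_def by blast
  have "papp app (app k k) (Some x) \<simeq> Some k" for x
    using ks unfolding combinators_ks_def by blast
  then have "app c x = Some k" for x
    using c by (simp add: papp_def pcong_def)
  moreover have "c \<in> A'"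
    using closed[OF k_in k_in c] .
  ultimately show "(\<lambda>x\<in>X. k) \<in> computable_funs app A' X {k}"
    unfolding computable_funs_def by auto
next
  fix f assume "f \<in> computable_funs app A' X {k}"
  then have "f \<in> X \<rightarrow>\<^sub>E {k}"
    unfolding computable_funs_def by blast
  then show "f = (\<lambda>x\<in>X. k)"
    by (auto simp: PiE_iff extensional_def restrict_def fun_eq_iff)
qed


section \<open>Poset reflections and order isomorphism\<close>

definition poset_reflection :: "'b set \<Rightarrow> ('b \<Rightarrow> 'b \<Rightarrow> bool) \<Rightarrow> 'b set gorder" where
  "poset_reflection S r =
     \<lparr> carrier = S // {(x, y). x \<in> S \<and> y \<in> S \<and> r x y \<and> r y x},
       eq = (=),
       le = (\<lambda>C D. \<exists>x\<in>C. \<exists>y\<in>D. r x y) \<rparr>"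

definition order_isomorphic :: "'b gorder \<Rightarrow> 'c gorder \<Rightarrow> bool" where
  "order_isomorphic P Q \<longleftrightarrow> (\<exists>\<phi>. bij_betw \<phi> (carrier P) (carrier Q) \<and>
     (\<forall>x\<in>carrier P. \<forall>y\<in>carrier P. x \<sqsubseteq>\<^bsub>P\<^esub> y \<longleftrightarrow> \<phi> x \<sqsubseteq>\<^bsub>Q\<^esub> \<phi> y))"


section \<open>Weihrauch degrees\<close>

definition nonempty_sets :: "'a set set" where
  "nonempty_sets = {S. S \<noteq> {}}"

text \<open>A partial multi-valued function is given together with its domain, as a pair \<open>(X, f)\<close>;
  \<open>f\<close> is extensional, so that equality of such pairs is equality of functions on \<open>X\<close>.\<close>

type_synonym 'a pmv = "'a set \<times> ('a \<Rightarrow> 'a set)"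

definition pmv_funs :: "'a pmv set" where
  "pmv_funs = {(X, f). f \<in> X \<rightarrow>\<^sub>E nonempty_sets}"

text \<open>\<open>app a b \<in> Some ` S\<close> says that the application is defined and its value lies in \<open>S\<close>.\<close>

definition weihrauch_le ::
    "('a \<Rightarrow> 'a \<Rightarrow> 'a option) \<Rightarrow> 'a set \<Rightarrow> 'a \<Rightarrow> 'a pmv \<Rightarrow> 'a pmv \<Rightarrow> bool" where
  "weihrauch_le app A' pr = (\<lambda>(X, f) (Z, g).
     \<exists>\<kappa> \<in> computable_funs app A' X Z. \<exists>h \<in> A'.
       \<forall>p\<in>X. \<forall>q \<in> g (\<kappa> p). app h (pairing app pr p q) \<in> Some ` f p)"

definition weihrauch_degrees ::
    "('a \<Rightarrow> 'a \<Rightarrow> 'a option) \<Rightarrow> 'a set \<Rightarrow> 'a \<Rightarrow> 'a pmv set gorder" where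
  "weihrauch_degrees app A' pr = poset_reflection pmv_funs (weihrauch_le app A' pr)"


section \<open>The Weihrauch doctrine\<close>

text \<open>A generalized Weihrauch predicate on \<open>X\<close> is a pair \<open>(Y, F)\<close> with \<open>F\<close> a function from \<open>X\<close>
  to the functions from \<open>Y\<close> to nonempty sets.\<close>

type_synonym 'a gen_pred = "'a set \<times> ('a \<Rightarrow> 'a \<Rightarrow> 'a set)"

definition gen_weihrauch_preds :: "'a set \<Rightarrow> 'a gen_pred set" where
  "gen_weihrauch_preds X = {(Y, F). F \<in> X \<rightarrow>\<^sub>E (Y \<rightarrow>\<^sub>E nonempty_sets)}"

definition gen_weihrauch_le ::
    "('a \<Rightarrow> 'a \<Rightarrow> 'a option) \<Rightarrow> 'a set \<Rightarrow> 'a \<Rightarrow> 'a set \<Rightarrow> 'a gen_pred \<Rightarrow> 'a gen_pred \<Rightarrow> bool" where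
  "gen_weihrauch_le app A' pr X = (\<lambda>(Y, F) (Z, G).
     \<exists>\<kappa> \<in> computable_funs app A' (mod_prod app pr X Y) Z. \<exists>h \<in> A'.
       \<forall>x\<in>X. \<forall>y\<in>Y. \<forall>q \<in> G x (\<kappa> (pairing app pr x y)).
         app h (pairing app pr (pairing app pr x y) q) \<in> Some ` F x y)"

text \<open>The value of the doctrine at the object \<open>X\<close>.\<close>

definition weihrauch_doctrine ::
    "('a \<Rightarrow> 'a \<Rightarrow> 'a option) \<Rightarrow> 'a set \<Rightarrow> 'a \<Rightarrow> 'a set \<Rightarrow> 'a gen_pred set gorder" where
  "weihrauch_doctrine app A' pr X =
     poset_reflection (gen_weihrauch_preds X) (gen_weihrauch_le app A' pr X)"

end

theory Submission
  imports Defs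
begin

text \<open>
  A generalized predicate \<open>F\<close> over \<open>{k}\<close> with index set \<open>Y\<close> is the same thing as the multi-valued
  function \<open>F k\<close> on \<open>Y\<close>.  The two reducibilities differ only in that one feeds realizers with \<open>y\<close>
  and the other with \<open>\<langle>k, y\<rangle>\<close>; since \<open>k\<close> lies in the sub-PCA, these inputs are computable from each
  other, so this bijection preserves and reflects the preorders and passes to poset reflections.
\<close>

text \<open>The isomorphism is the direct image. Since \<open>f\<close> is onto \<open>T\<close> and
  \<open>r\<close> agrees with \<open>r'\<close> along \<open>f\<close>, it carries the class of
  \<open>x\<close> onto the class of \<open>f x\<close>. Classes are compared through
  representatives, so the order transfers elementwise.\<close>

lemma order_isomorphic_poset_reflection:
  assumes bij: "bij_betw f S T"
    and le: "\<And>x y. x \<in> S \<Longrightarrow> y \<in> S \<Longrightarrow> r x y \<longleftrightarrow> r' (f x) (f y)"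
  shows "order_isomorphic (poset_reflection S r) (poset_reflection T r')"
proof -
  define R where "R = {(x, y). x \<in> S \<and> y \<in> S \<and> r x y \<and> r y x}"
  define R' where "R' = {(x, y). x \<in> T \<and> y \<in> T \<and> r' x y \<and> r' y x}"
  have T: "T = f ` S" and inj: "inj_on f S"
    using bij by (auto simp: bij_betw_def)
  have sub: "C \<subseteq> S" if "C \<in> S // R" for C
    using that by (auto simp: quotient_def R_def)
  have cls: "f ` (R `` {x}) = R' `` {f x}" if "x \<in> S" for x
    using that le by (auto simp: R_def R'_def T)
  have "(`) f ` (S // R) = T // R'"
    using cls by (auto simp: quotient_def T image_UN)
  moreover have "inj_on ((`) f) (S // R)"
    \<comment> \<open>Direct image along an injection is injective on all subsets of
      \<open>S\<close>, and classes are such subsets.\<close>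
    by (rule inj_on_subset[OF inj_on_image_Pow[OF inj]]) (use sub in auto)
  ultimately have "bij_betw ((`) f) (S // R) (T // R')"
    by (simp add: bij_betw_def)
  moreover have "(\<exists>x\<in>C. \<exists>y\<in>D. r x y) \<longleftrightarrow> (\<exists>x\<in>f ` C. \<exists>y\<in>f ` D. r' x y)"
    if "C \<in> S // R" "D \<in> S // R" for C D
    using sub[OF that(1)] sub[OF that(2)] le by (simp add: subset_iff)
  ultimately show ?thesis
    unfolding order_isomorphic_def poset_reflection_def R_def R'_def
    by (intro exI[of _ "(`) f"]) simp
qed

text \<open>The inverse evaluates at \<open>c\<close>; an extensional function on \<open>{c}\<close>
  is determined by that one value.\<close>

lemma bij_betw_gen_weihrauch_preds_singleton:
  "bij_betw (\<lambda>(X, f). (X, \<lambda>u\<in>{c}. f)) pmv_funs (gen_weihrauch_preds {c})"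
  by (rule bij_betwI[where g = "\<lambda>(Y, F). (Y, F c)"])
    (auto simp: pmv_funs_def gen_weihrauch_preds_def PiE_iff extensional_def restrict_def fun_eq_iff)

context elementary_sub_pca_choice
begin

lemma const_realizer:
  assumes "a \<in> A'"
  shows "\<exists>c\<in>A'. \<forall>x. app c x = Some a"
proof -
  obtain c where c: "app k a = Some c"
    using ks unfolding combinators_ks_def by blast
  have "papp app (app k a) (Some x) \<simeq> Some a" for x
    using ks unfolding combinators_ks_def by blast
  then have "app c x = Some a" for x
    using c by (simp add: papp_def pcong_def)
  moreover have "c \<in> A'"
    using closed[OF k_in assms c] .
  ultimately show ?thesis by blast
qed

text \<open>The element is \<open>s a b\<close>. The law for \<open>s\<close> is directed:
  definedness of the right-hand side gives that of the left. Hence implications from defined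
  intermediate values, not an equation.\<close>

lemma apply_realizer:
  assumes "a \<in> A'" "b \<in> A'"
  shows "\<exists>c\<in>A'. \<forall>x u v w. app a x = Some u \<longrightarrow> app b x = Some v \<longrightarrow> app u v = Some w \<longrightarrow>
    app c x = Some w"
proof -
  obtain d where d: "app s a = Some d"
    using ks unfolding combinators_ks_def by blast
  have "papp app (app s a) (Some b) \<noteq> None"
    using ks unfolding combinators_ks_def by blast
  then obtain c where c: "app d b = Some c"
    using d by (auto simp: papp_def)
  have "papp app (papp app (app s a) (Some b)) (Some x) \<simeq> papp app (app a x) (app b x)" for x
    using ks unfolding combinators_ks_def by blast
  then have "app c x = Some w"
    if "app a x = Some u" "app b x = Some v" "app u v = Some w" for x u v w
    using c d that by (auto simp: papp_def pcong_def)
  moreover have "c \<in> A'"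
    using closed[OF closed[OF s_in assms(1) d] assms(2) c] .
  ultimately show ?thesis by blast
qed

text \<open>Composition is \<open>s (k a) b\<close>, where \<open>k a\<close> is the constant
  realizer \<open>d\<close>.\<close>

lemma comp_realizer:
  assumes "a \<in> A'" "b \<in> A'"
  shows "\<exists>c\<in>A'. \<forall>x v w. app b x = Some v \<longrightarrow> app a v = Some w \<longrightarrow> app c x = Some w"
proof -
  obtain d where "d \<in> A'" and d: "\<And>x. app d x = Some a"
    using const_realizer[OF assms(1)] by blast
  show ?thesis
    using apply_realizer[OF \<open>d \<in> A'\<close> assms(2)] d by blast
qed

text \<open>The identity is \<open>s k k\<close>: both copies of \<open>k x\<close> are defined, and
  \<open>k x (k x)\<close> is \<open>x\<close>.\<close>

lemma id_realizer: "\<exists>c\<in>A'. \<forall>x. app c x = Some x"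
proof -
  have "\<exists>u v. app k x = Some u \<and> app k x = Some v \<and> app u v = Some x" for x
  proof -
    obtain u where u: "app k x = Some u"
      using ks unfolding combinators_ks_def by blast
    have "papp app (app k x) (Some u) \<simeq> Some x"
      using ks unfolding combinators_ks_def by blast
    then show ?thesis
      using u by (simp add: papp_def pcong_def)
  qed
  then show ?thesis
    using apply_realizer[OF k_in k_in] by blast
qed

text \<open>Strictness of \<open>papp\<close> turns the first projection law, whose right-hand side
  is defined, into definedness of the pair itself.\<close>

lemma app_pr:
  "\<exists>u. app pr a = Some u \<and> app u b = Some (pairing app pr a b)"
proof -
  have "papp app (app pr a) (Some b) \<noteq> None"
    using fst_pair[of a b] by (auto simp: papp_def split: Option.bind_splits)
  then show ?thesis
    by (auto simp: pairing_def papp_def split: Option.bind_splits)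
qed

lemma app_p0_pairing [simp]: "app p0 (pairing app pr a b) = Some a"
  and app_p1_pairing [simp]: "app p1 (pairing app pr a b) = Some b"
  using app_pr[of a b] fst_pair[of a b] snd_pair[of a b] by (auto simp: papp_def)

text \<open>With \<open>d\<close> realizing \<open>pr\<close> after \<open>a\<close>, the element
  \<open>s d b\<close> sends \<open>x\<close> to the pair of the values of \<open>a\<close> and
  \<open>b\<close> at \<open>x\<close>.\<close>

lemma pairing_realizer:
  assumes "a \<in> A'" "b \<in> A'"
  shows "\<exists>c\<in>A'. \<forall>x u v. app a x = Some u \<longrightarrow> app b x = Some v \<longrightarrow>
    app c x = Some (pairing app pr u v)"
proof -
  obtain d where "d \<in> A'" and d: "\<And>x u w. app a x = Some u \<Longrightarrow> app pr u = Some w \<Longrightarrow> app d x = Some w"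
    using comp_realizer[OF pr_in assms(1)] by blast
  obtain c where "c \<in> A'"
    and c: "\<And>x u v w. app d x = Some u \<Longrightarrow> app b x = Some v \<Longrightarrow> app u v = Some w \<Longrightarrow> app c x = Some w"
    using apply_realizer[OF \<open>d \<in> A'\<close> assms(2)] by blast
  have "app c x = Some (pairing app pr u v)" if "app a x = Some u" "app b x = Some v" for x u v
    using app_pr[of u v] c d that by blast
  with \<open>c \<in> A'\<close> show ?thesis by blast
qed

text \<open>In this direction the new realizers only have to discard \<open>c\<close>, which the
  projections do.\<close>

lemma weihrauch_le_imp_gen_weihrauch_le:
  assumes "weihrauch_le app A' pr (X, f) (Z, g)"
  shows "gen_weihrauch_le app A' pr {c} (X, \<lambda>u\<in>{c}. f) (Z, \<lambda>u\<in>{c}. g)"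
proof -
  obtain \<kappa> a h where \<kappa>: "\<kappa> \<in> X \<rightarrow>\<^sub>E Z" and a: "a \<in> A'" "\<And>x. x \<in> X \<Longrightarrow> app a x = Some (\<kappa> x)"
    and h: "h \<in> A'" "\<And>p q. p \<in> X \<Longrightarrow> q \<in> g (\<kappa> p) \<Longrightarrow> app h (pairing app pr p q) \<in> Some ` f p"
    using assms unfolding weihrauch_le_def computable_funs_def by auto
  let ?P = "mod_prod app pr {c} X"
  \<comment> \<open>Every element of \<open>?P\<close> is a pair of \<open>c\<close> and some
    \<open>y\<close> in \<open>X\<close>, so \<open>the\<close> meets a defined value, namely
    \<open>y\<close>.\<close>
  define \<kappa>' where "\<kappa>' = (\<lambda>z\<in>?P. \<kappa> (the (app p1 z)))"
  obtain b where "b \<in> A'" and b: "\<And>x v w. app p1 x = Some v \<Longrightarrow> app a v = Some w \<Longrightarrow> app b x = Some w"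
    using comp_realizer[OF a(1) p1_in] by blast
  have "\<kappa>' \<in> computable_funs app A' ?P Z"
    unfolding computable_funs_def
    using \<open>b \<in> A'\<close> b a(2) \<kappa> by (auto simp: \<kappa>'_def mod_prod_def PiE_iff intro!: bexI[of _ b])
  moreover have "\<kappa>' (pairing app pr c y) = \<kappa> y" if "y \<in> X" for y
    using that by (auto simp: \<kappa>'_def mod_prod_def)
  \<comment> \<open>\<open>d\<close> extracts \<open>y\<close> from \<langle>\<langle>c, y\<rangle>,
    q\<rangle>, and \<open>e\<close> rearranges that input to \<langle>y, q\<rangle>, as
    \<open>h\<close> expects.\<close>
  moreover obtain d where "d \<in> A'"
    and d: "\<And>x v w. app p0 x = Some v \<Longrightarrow> app p1 v = Some w \<Longrightarrow> app d x = Some w"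
    using comp_realizer[OF p1_in p0_in] by blast
  obtain e where "e \<in> A'" and e: "\<And>x u v. app d x = Some u \<Longrightarrow> app p1 x = Some v \<Longrightarrow>
      app e x = Some (pairing app pr u v)"
    using pairing_realizer[OF \<open>d \<in> A'\<close> p1_in] by blast
  obtain h' where "h' \<in> A'"
    and h': "\<And>x v w. app e x = Some v \<Longrightarrow> app h v = Some w \<Longrightarrow> app h' x = Some w"
    using comp_realizer[OF h(1) \<open>e \<in> A'\<close>] by blast
  have "app e (pairing app pr (pairing app pr c y) q) = Some (pairing app pr y q)" for y q
    by (rule e[OF d]) (rule app_p0_pairing app_p1_pairing)+
  then have "app h' (pairing app pr (pairing app pr c y) q) \<in> Some ` f y"
    if "y \<in> X" "q \<in> g (\<kappa> y)" for y q
    using h(2)[OF that] h' by fastforce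
  ultimately show ?thesis
    using \<open>h' \<in> A'\<close> unfolding gen_weihrauch_le_def
    by (auto intro!: bexI[of _ \<kappa>'] bexI[of _ h'])
qed

text \<open>Here \<open>c\<close> has to be inserted into the input by a realizer from
  \<open>A'\<close>, which is possible because \<open>c\<close> lies in \<open>A'\<close>.\<close>

lemma gen_weihrauch_le_imp_weihrauch_le:
  assumes "c \<in> A'" "gen_weihrauch_le app A' pr {c} (X, \<lambda>u\<in>{c}. f) (Z, \<lambda>u\<in>{c}. g)"
  shows "weihrauch_le app A' pr (X, f) (Z, g)"
proof -
  let ?P = "mod_prod app pr {c} X"
  obtain \<kappa> a h where \<kappa>: "\<kappa> \<in> ?P \<rightarrow>\<^sub>E Z" and a: "a \<in> A'" "\<And>x. x \<in> ?P \<Longrightarrow> app a x = Some (\<kappa> x)"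
    and h: "h \<in> A'" "\<And>y q. y \<in> X \<Longrightarrow> q \<in> g (\<kappa> (pairing app pr c y)) \<Longrightarrow>
      app h (pairing app pr (pairing app pr c y) q) \<in> Some ` f y"
    using assms(2) unfolding gen_weihrauch_le_def computable_funs_def by auto
  have P: "pairing app pr c y \<in> ?P" if "y \<in> X" for y
    using that by (auto simp: mod_prod_def)
  define \<kappa>' where "\<kappa>' = (\<lambda>y\<in>X. \<kappa> (pairing app pr c y))"
  obtain i where "i \<in> A'" and i: "\<And>x. app i x = Some x"
    using id_realizer by blast
  obtain j where "j \<in> A'" and j: "\<And>x. app j x = Some c"
    using const_realizer[OF assms(1)] by blast
  \<comment> \<open>Pairing the constant \<open>c\<close> with the identity gives the insertion of
    \<open>c\<close>.\<close>
  obtain l where "l \<in> A'" and l: "\<And>x. app l x = Some (pairing app pr c x)"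
    using pairing_realizer[OF \<open>j \<in> A'\<close> \<open>i \<in> A'\<close>] i j by blast
  obtain b where "b \<in> A'" and b: "\<And>x w. app a (pairing app pr c x) = Some w \<Longrightarrow> app b x = Some w"
    using comp_realizer[OF a(1) \<open>l \<in> A'\<close>] l by blast
  have "\<kappa>' \<in> computable_funs app A' X Z"
    unfolding computable_funs_def
    using \<open>b \<in> A'\<close> b a(2) \<kappa> P by (auto simp: \<kappa>'_def PiE_iff intro!: bexI[of _ b])
  \<comment> \<open>\<open>d\<close> sends \<langle>y, q\<rangle> to \<langle>c, y\<rangle>, and
    \<open>e\<close> then restores the input \<langle>\<langle>c, y\<rangle>, q\<rangle> of
    \<open>h\<close>.\<close>
  moreover obtain d where "d \<in> A'"
    and d: "\<And>x v. app p0 x = Some v \<Longrightarrow> app d x = Some (pairing app pr c v)"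
    using comp_realizer[OF \<open>l \<in> A'\<close> p0_in] l by blast
  obtain e where "e \<in> A'" and e: "\<And>x u v. app d x = Some u \<Longrightarrow> app p1 x = Some v \<Longrightarrow>
      app e x = Some (pairing app pr u v)"
    using pairing_realizer[OF \<open>d \<in> A'\<close> p1_in] by blast
  obtain h' where "h' \<in> A'"
    and h': "\<And>x v w. app e x = Some v \<Longrightarrow> app h v = Some w \<Longrightarrow> app h' x = Some w"
    using comp_realizer[OF h(1) \<open>e \<in> A'\<close>] by blast
  have "app e (pairing app pr y q) = Some (pairing app pr (pairing app pr c y) q)" for y q
    by (rule e[OF d]) (rule app_p0_pairing app_p1_pairing)+
  then have "app h' (pairing app pr y q) \<in> Some ` f y" if "y \<in> X" "q \<in> g (\<kappa>' y)" for y q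
    using h(2)[of y q] h' that by (fastforce simp: \<kappa>'_def)
  ultimately show ?thesis
    using \<open>h' \<in> A'\<close> unfolding weihrauch_le_def by blast
qed

end

theorem theorem5p11:
  fixes app :: "'a \<Rightarrow> 'a \<Rightarrow> 'a option" and A' :: "'a set" and k s pr p0 p1 :: 'a
  assumes "elementary_sub_pca_choice app A' k s pr p0 p1"
  shows "order_isomorphic (weihrauch_degrees app A' pr) (weihrauch_doctrine app A' pr {k})"
proof -
  interpret elementary_sub_pca_choice app A' k s pr p0 p1
    by (fact assms)
  show ?thesis
    unfolding weihrauch_degrees_def weihrauch_doctrine_def
    by (rule order_isomorphic_poset_reflection[OF bij_betw_gen_weihrauch_preds_singleton])
      (auto simp del: restrict_apply intro: weihrauch_le_imp_gen_weihrauch_le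
        gen_weihrauch_le_imp_weihrauch_le[OF k_in])
qed

end
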